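(* Let $n\ge2$, $\gamma>0$, and let $Cone_\Sigma\subset\mathbb{R}^n$ be a $C^{1,1}$ epigraphical cone with norms $(L,K)$ whose frequency $\phi=\phi_\Sigma$ satisfies $\phi=\frac{2}{1+\gamma}$. Let $\Omega=Cone_\Sigma\cap B_1$, let $U$ be the solution of $-\Delta U=U^{-\gamma}$ in $\Omega$, $U=0$ on $\partial\Omega$, and for $k\ge1$ let $p_k=\frac{16^{1-k}}{2}\vec e_n$ and $a_k=16^{k\phi}U(p_k)$. Then $a_1\sim1$ and $a_{k+1}\ge a_k$ for every $k\ge1$.
   Context: $B_r$ is the open ball of radius $r$ centered at $0$ in $\mathbb{R}^n$; points are written $x=(x',x_n)$, $B_r'$ is the ball in $\mathbb{R}^{n-1}$, and $\vec e_n$ is the $n$-th unit vector. Cones: for $\Sigma\subseteq\partial B_1=\mathbb{S}^{n-1}$, $Cone_\Sigma=\{x\in\mathbb{R}^n\setminus\{0\}: x/|x|\in\Sigma\}$. It is a $C^{1,1}$ epigraphical cone if $Cone_\Sigma=\{x_n>g(x')\}$ for some $g:\mathbb{R}^{n-1}\to\mathbb{R}$ with $g(\lambda x')=\lambda g(x')$ for all $\lambda\ge0$, and $g\in C^{1,1}(B_2'\setminus B_1')$. Its norms are $L=\|g\|_{C^{0,1}(B_2'\setminus B_1')}$ and $K=[g]_{C^{1,1}(B_2'\setminus B_1')}$. Frequency: let $\lambda_\Sigma$ be the first Dirichlet eigenvalue of the Laplace-Beltrami operator $-\Delta_\Sigma$ on $\Sigma$; the frequency $\phi_\Sigma$ is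 the positive solution of $\phi(\phi+n-2)=\lambda_\Sigma$. $q_1\sim q_2$ means $C^{-1}q_2\le q_1\le Cq_2$ for a constant $C>0$ depending only on $(n,\gamma,L,K)$. $U$ is the unique positive function in $C^\infty(\Omega)\cap C(\overline\Omega)$ solving the Dirichlet problem. *)

theory Defs
  imports "HOL-Analysis.Analysis"
begin

text \<open>Points of $R^n$ are written $(x', x_n)$ and live in \<open>(real ^ 'm) \<times> real\<close>, whose norm is the
  Euclidean one. Thus $n$ is \<open>CARD('m) + 1\<close>, i.e. \<open>DIM((real ^ 'm) \<times> real)\<close>, and $n \ge 2$ holds
  automatically.\<close>

subsection \<open>Smooth functions and the Laplacian\<close>

definition partial_deriv :: "'a::euclidean_space \<Rightarrow> ('a \<Rightarrow> real) \<Rightarrow> 'a \<Rightarrow> real" where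
  "partial_deriv b f x = frechet_derivative f (at x) b"

text \<open>Only meaningful on open sets.\<close>

fun Ck_on :: "nat \<Rightarrow> 'a::euclidean_space set \<Rightarrow> ('a \<Rightarrow> real) \<Rightarrow> bool" where
  "Ck_on 0 S f \<longleftrightarrow> continuous_on S f"
| "Ck_on (Suc k) S f \<longleftrightarrow>
     (\<forall>x\<in>S. f differentiable (at x)) \<and> (\<forall>b\<in>Basis. Ck_on k S (partial_deriv b f))"

definition Cinf_on :: "'a::euclidean_space set \<Rightarrow> ('a \<Rightarrow> real) \<Rightarrow> bool" where
  "Cinf_on S f \<longleftrightarrow> (\<forall>k. Ck_on k S f)"

definition laplacian :: "('a::euclidean_space \<Rightarrow> real) \<Rightarrow> 'a \<Rightarrow> real" where
  "laplacian f x = (\<Sum>b\<in>Basis. partial_deriv b (partial_deriv b f) x)"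

subsection \<open>$C^{0,1}$ and $C^{1,1}$\<close>

text \<open>One-sided gradient relative to \<open>S\<close>, since $B_2' \setminus B_1'$ contains its inner boundary
  sphere. On that set the within-derivative is unique.\<close>

definition grad_within :: "'a::euclidean_space set \<Rightarrow> ('a \<Rightarrow> real) \<Rightarrow> 'a \<Rightarrow> 'a" where
  "grad_within S g x = (\<Sum>b\<in>Basis. frechet_derivative g (at x within S) b *\<^sub>R b)"

definition C01_on :: "'a::euclidean_space set \<Rightarrow> ('a \<Rightarrow> real) \<Rightarrow> bool" where
  "C01_on S g \<longleftrightarrow> bounded (g ` S) \<and> (\<exists>M. M-lipschitz_on S g)"

definition C11_on :: "'a::euclidean_space set \<Rightarrow> ('a \<Rightarrow> real) \<Rightarrow> bool" where
  "C11_on S g \<longleftrightarrow> C01_on S g \<and> (\<forall>x\<in>S. g differentiable (at x within S))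
     \<and> (\<exists>M. M-lipschitz_on S (grad_within S g))"

definition lip_seminorm :: "'a::metric_space set \<Rightarrow> ('a \<Rightarrow> 'b::metric_space) \<Rightarrow> real" where
  "lip_seminorm S f =
     Sup {dist (f x) (f y) / dist x y | x y. x \<in> S \<and> y \<in> S \<and> x \<noteq> y}"

text \<open>The suprema below are over nonempty bounded sets whenever \<open>C11_on S g\<close> holds and \<open>S\<close> has at
  least two points.\<close>

definition C01_norm :: "'a::euclidean_space set \<Rightarrow> ('a \<Rightarrow> real) \<Rightarrow> real" where
  "C01_norm S g = (SUP x\<in>S. \<bar>g x\<bar>) + lip_seminorm S g"

definition C11_seminorm :: "'a::euclidean_space set \<Rightarrow> ('a \<Rightarrow> real) \<Rightarrow> real" where
  "C11_seminorm S g = lip_seminorm S (grad_within S g)"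

subsection \<open>Cones\<close>

definition Cone_over :: "'a::euclidean_space set \<Rightarrow> 'a set" where
  "Cone_over \<Sigma> = {x. x \<noteq> 0 \<and> x /\<^sub>R norm x \<in> \<Sigma>}"

definition C11_epigraphical_cone ::
  "((real ^ 'm) \<times> real) set \<Rightarrow> (real ^ 'm \<Rightarrow> real) \<Rightarrow> real \<Rightarrow> real \<Rightarrow> bool" where
  "C11_epigraphical_cone \<Sigma> g L K \<longleftrightarrow>
     \<Sigma> \<subseteq> sphere 0 1 \<and>
     Cone_over \<Sigma> = {(x', xn). xn > g x'} \<and>
     (\<forall>t\<ge>0. \<forall>x'. g (t *\<^sub>R x') = t * g x') \<and>
     C11_on (ball 0 2 - ball 0 1) g \<and>
     C01_norm (ball 0 2 - ball 0 1) g = L \<and>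
     C11_seminorm (ball 0 2 - ball 0 1) g = K"

subsection \<open>First Dirichlet eigenvalue and frequency\<close>

text \<open>A function on (a subset of) the unit sphere is differentiated through its extension that is
  homogeneous of degree 0, i.e. constant along rays. On the sphere the Euclidean Laplacian of that
  extension is the Laplace--Beltrami operator of the round metric.\<close>

definition radial_ext :: "('a::euclidean_space \<Rightarrow> real) \<Rightarrow> 'a \<Rightarrow> real" where
  "radial_ext f x = f (x /\<^sub>R norm x)"

definition sphere_laplacian :: "('a::euclidean_space \<Rightarrow> real) \<Rightarrow> 'a \<Rightarrow> real" where
  "sphere_laplacian f \<theta> = laplacian (radial_ext f) \<theta>"

text \<open>The boundary of \<open>\<Sigma>\<close> is taken relative to the sphere.\<close>

definition dirichlet_eigenfunction ::
  "'a::euclidean_space set \<Rightarrow> real \<Rightarrow> ('a \<Rightarrow> real) \<Rightarrow> bool" where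
  "dirichlet_eigenfunction \<Sigma> \<mu> f \<longleftrightarrow>
     Cinf_on (Cone_over \<Sigma>) (radial_ext f) \<and>
     continuous_on (closure \<Sigma>) f \<and>
     (\<forall>\<theta> \<in> (top_of_set (sphere 0 1)) frontier_of \<Sigma>. f \<theta> = 0) \<and>
     (\<exists>\<theta>\<in>\<Sigma>. f \<theta> \<noteq> 0) \<and>
     (\<forall>\<theta>\<in>\<Sigma>. - sphere_laplacian f \<theta> = \<mu> * f \<theta>)"

definition dirichlet_eigenvalue :: "'a::euclidean_space set \<Rightarrow> real \<Rightarrow> bool" where
  "dirichlet_eigenvalue \<Sigma> \<mu> \<longleftrightarrow> (\<exists>f. dirichlet_eigenfunction \<Sigma> \<mu> f)"

definition first_dirichlet_eigenvalue :: "'a::euclidean_space set \<Rightarrow> real \<Rightarrow> bool" where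
  "first_dirichlet_eigenvalue \<Sigma> \<mu> \<longleftrightarrow>
     dirichlet_eigenvalue \<Sigma> \<mu> \<and> (\<forall>\<nu>. dirichlet_eigenvalue \<Sigma> \<nu> \<longrightarrow> \<mu> \<le> \<nu>)"

definition is_frequency :: "'a::euclidean_space set \<Rightarrow> real \<Rightarrow> bool" where
  "is_frequency \<Sigma> \<phi> \<longleftrightarrow> \<phi> > 0 \<and>
     (\<exists>\<mu>. first_dirichlet_eigenvalue \<Sigma> \<mu> \<and> \<phi> * (\<phi> + real DIM('a) - 2) = \<mu>)"

subsection \<open>The singular Dirichlet problem\<close>

definition singular_solution ::
  "'a::euclidean_space set \<Rightarrow> real \<Rightarrow> ('a \<Rightarrow> real) \<Rightarrow> bool" where
  "singular_solution \<Omega> \<gamma> U \<longleftrightarrow>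
     Cinf_on \<Omega> U \<and> continuous_on (closure \<Omega>) U \<and> (\<forall>x\<in>\<Omega>. U x > 0) \<and>
     (\<forall>x\<in>\<Omega>. - laplacian U x = U x powr (- \<gamma>)) \<and>
     (\<forall>x\<in>frontier \<Omega>. U x = 0)"

definition p_seq :: "nat \<Rightarrow> (real ^ 'm) \<times> real" where
  "p_seq k = (16 powi (1 - int k) / 2) *\<^sub>R (0, 1)"

definition a_seq :: "real \<Rightarrow> ((real ^ 'm) \<times> real \<Rightarrow> real) \<Rightarrow> nat \<Rightarrow> real" where
  "a_seq \<phi> U k = 16 powr (real k * \<phi>) * U (p_seq k)"

end

theory Submission
  imports Defs
begin

text \<open>Since \<open>t \<mapsto> t powr - \<gamma>\<close> is decreasing, super- and subsolutions of \<open>- \<Delta> u = u powr - \<gamma>\<close> are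
  ordered by their boundary values: at a negative interior minimum of the difference the second
  derivative test is violated. The relation \<open>\<phi> (1 + \<gamma>) = 2\<close> makes the equation invariant under
  \<open>U \<mapsto> 16 powr \<phi> * U (x / 16)\<close>, and the rescaled solution is nonnegative on the boundary of the
  original domain; it therefore dominates \<open>U\<close>, which is the monotonicity of \<open>a_seq\<close>. Comparison with
  \<open>2 - |x|^2\<close> in the domain, and with a small concave paraboloid in a ball about \<open>p_seq 1\<close> whose
  radius depends only on \<open>L\<close>, bounds \<open>a_seq \<phi> U 1\<close> from both sides.\<close>

section \<open>The comparison principle\<close>

definition twice_diff_on :: "'a::euclidean_space set \<Rightarrow> ('a \<Rightarrow> real) \<Rightarrow> bool" where
  "twice_diff_on S f \<longleftrightarrow> (\<forall>x\<in>S. f differentiable (at x)) \<and>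
     (\<forall>b\<in>Basis. \<forall>x\<in>S. partial_deriv b f differentiable (at x))"

lemma Cinf_on_imp_twice_diff_on: "Cinf_on S f \<Longrightarrow> twice_diff_on S f"
  unfolding Cinf_on_def twice_diff_on_def
  by (drule spec[of _ "Suc (Suc 0)"]) simp

lemma twice_diff_on_subset: "twice_diff_on S f \<Longrightarrow> T \<subseteq> S \<Longrightarrow> twice_diff_on T f"
  unfolding twice_diff_on_def by blast

lemma twice_diff_onI:
  fixes f :: "'a::euclidean_space \<Rightarrow> real"
  assumes "open S"
    and "\<And>x. x \<in> S \<Longrightarrow> (f has_derivative f' x) (at x)"
    and "\<And>b x. b \<in> Basis \<Longrightarrow> x \<in> S \<Longrightarrow> ((\<lambda>y. f' y b) has_derivative f'' b x) (at x)"
  shows "twice_diff_on S f" and "\<And>x. x \<in> S \<Longrightarrow> laplacian f x = (\<Sum>b\<in>Basis. f'' b x b)"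
proof -
  have 1: "partial_deriv b f x = f' x b" if "x \<in> S" for x b
    using frechet_derivative_at[OF assms(2)[OF that]] by (simp add: partial_deriv_def)
  have 2: "(partial_deriv b f has_derivative f'' b x) (at x)" if "b \<in> Basis" "x \<in> S" for b x
    by (rule has_derivative_transform_within_open[OF assms(3)[OF that] assms(1) that(2)])
      (simp add: 1)
  show "twice_diff_on S f"
    unfolding twice_diff_on_def differentiable_def using assms(2) 2 by blast
  show "laplacian f x = (\<Sum>b\<in>Basis. f'' b x b)" if "x \<in> S" for x
    unfolding laplacian_def
  proof (rule sum.cong[OF refl])
    fix b :: 'a assume "b \<in> Basis"
    from frechet_derivative_at[OF 2[OF this that]]
    show "partial_deriv b (partial_deriv b f) x = f'' b x b"
      by (simp add: partial_deriv_def)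
  qed
qed

lemma differentiable_along_line:
  fixes f :: "'a::euclidean_space \<Rightarrow> real"
  assumes "f differentiable (at (x + t *\<^sub>R b))"
  shows "((\<lambda>s. f (x + s *\<^sub>R b)) has_real_derivative partial_deriv b f (x + t *\<^sub>R b)) (at t)"
proof -
  let ?D = "frechet_derivative f (at (x + t *\<^sub>R b))"
  have D: "(f has_derivative ?D) (at (x + t *\<^sub>R b))"
    using assms by (simp add: frechet_derivative_works)
  have "((\<lambda>s. x + s *\<^sub>R b) has_derivative (\<lambda>s. s *\<^sub>R b)) (at t)"
    by (auto intro!: derivative_eq_intros)
  from has_derivative_compose[OF this D]
  have "((\<lambda>s. f (x + s *\<^sub>R b)) has_derivative (\<lambda>s. ?D (s *\<^sub>R b))) (at t)" .
  moreover have "?D (s *\<^sub>R b) = partial_deriv b f (x + t *\<^sub>R b) * s" for s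
    using linear_cmul[OF has_derivative_linear[OF D], of s b] by (simp add: partial_deriv_def)
  ultimately show ?thesis by (simp add: has_field_derivative_def)
qed

lemma second_derivative_nonneg_at_min:
  fixes h :: "real \<Rightarrow> real"
  assumes "e > 0"
    and h: "\<And>t. \<bar>t\<bar> < e \<Longrightarrow> (h has_real_derivative h' t) (at t)"
    and h': "(h' has_real_derivative l) (at 0)"
    and min: "\<And>t. \<bar>t\<bar> < e \<Longrightarrow> h 0 \<le> h t"
  shows "l \<ge> 0"
proof (rule ccontr)
  assume "\<not> l \<ge> 0"
  have "h' 0 = 0"
    by (rule DERIV_local_min[OF h[of 0] \<open>e > 0\<close>]) (use \<open>e > 0\<close> min in auto)
  with DERIV_neg_dec_right[OF h'] \<open>\<not> l \<ge> 0\<close>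
  obtain d where d: "d > 0" "\<And>s. 0 < s \<Longrightarrow> s < d \<Longrightarrow> h' s < 0" by auto
  define t where "t = min d e / 2"
  have t: "0 < t" "t < d" "t < e" using d(1) \<open>e > 0\<close> by (auto simp: t_def)
  have "h t < h 0"
  proof (rule DERIV_neg_imp_decreasing_open[OF t(1)])
    show "\<exists>y. (h has_real_derivative y) (at s) \<and> y < 0" if "0 < s" "s < t" for s
      using h[of s] d(2)[of s] that t by (intro exI[of _ "h' s"]) auto
    show "continuous_on {0..t} h"
      using h t by (intro continuous_at_imp_continuous_on ballI DERIV_isCont[OF h]) auto
  qed
  with min[of t] t show False by simp
qed

lemma laplacian_le_at_min_of_diff:
  fixes u v :: "'a::euclidean_space \<Rightarrow> real"
  assumes "open S" "x \<in> S" "twice_diff_on S u" "twice_diff_on S v"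
    and min: "\<And>y. y \<in> S \<Longrightarrow> u x - v x \<le> u y - v y"
  shows "laplacian v x \<le> laplacian u x"
  unfolding laplacian_def
proof (rule sum_mono)
  fix b :: 'a assume b: "b \<in> Basis"
  obtain e where e: "e > 0" "ball x e \<subseteq> S" using assms(1,2) open_contains_ball by blast
  have inS: "x + t *\<^sub>R b \<in> S" if "\<bar>t\<bar> < e" for t
    using e(2) that b by (auto simp: dist_norm)
  define h where "h f t = f (x + t *\<^sub>R b)" for f :: "'a \<Rightarrow> real" and t
  define D where "D = partial_deriv b"
  have d1: "(h f has_real_derivative h (D f) t) (at t)"
    if "twice_diff_on S f" "\<bar>t\<bar> < e" for f t
    unfolding h_def D_def
    by (rule differentiable_along_line) (use that inS in \<open>auto simp: twice_diff_on_def\<close>)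
  have d2: "(h (D f) has_real_derivative D (D f) x) (at 0)" if "twice_diff_on S f" for f
    using differentiable_along_line[of "D f" x 0 b] that assms(2) b
    by (simp add: twice_diff_on_def h_def[abs_def] D_def)
  have "D (D u) x - D (D v) x \<ge> 0"
  proof (rule second_derivative_nonneg_at_min[OF e(1),
        of "\<lambda>t. h u t - h v t" "\<lambda>t. h (D u) t - h (D v) t"])
    show "((\<lambda>t. h u t - h v t) has_real_derivative h (D u) t - h (D v) t) (at t)"
      if "\<bar>t\<bar> < e" for t using that assms(3,4) by (intro DERIV_diff d1)
    show "((\<lambda>t. h (D u) t - h (D v) t) has_real_derivative D (D u) x - D (D v) x) (at 0)"
      using assms(3,4) by (intro DERIV_diff d2)
    show "h u 0 - h v 0 \<le> h u t - h v t" if "\<bar>t\<bar> < e" for t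
      using min[OF inS[OF that]] by (simp add: h_def)
  qed
  then show "partial_deriv b (partial_deriv b v) x \<le> partial_deriv b (partial_deriv b u) x"
    by (simp add: D_def)
qed

lemma comparison_principle:
  fixes u v :: "'a::euclidean_space \<Rightarrow> real"
  assumes "open S" "bounded S" "twice_diff_on S u" "twice_diff_on S v"
    and "continuous_on (closure S) u" "continuous_on (closure S) v"
    and bd: "\<And>x. x \<in> frontier S \<Longrightarrow> v x \<le> u x"
    and lap: "\<And>x. x \<in> S \<Longrightarrow> u x < v x \<Longrightarrow> laplacian u x < laplacian v x"
    and "x \<in> S"
  shows "v x \<le> u x"
proof (rule ccontr)
  assume neg: "\<not> v x \<le> u x"
  have "compact (closure S)" using assms(2) by simp
  moreover have "closure S \<noteq> {}" using \<open>x \<in> S\<close> closure_subset by blast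
  moreover have "continuous_on (closure S) (\<lambda>y. u y - v y)"
    by (intro continuous_intros assms)
  ultimately obtain z where z: "z \<in> closure S" "\<And>y. y \<in> closure S \<Longrightarrow> u z - v z \<le> u y - v y"
    using continuous_attains_inf[of "closure S" "\<lambda>y. u y - v y"] by blast
  have "u z < v z" using z(2)[of x] \<open>x \<in> S\<close> neg closure_subset[of S] by auto
  have "z \<in> S"
    using z(1) bd[of z] \<open>u z < v z\<close> by (auto simp: frontier_def interior_open[OF assms(1)])
  have "laplacian v z \<le> laplacian u z"
    by (rule laplacian_le_at_min_of_diff[OF assms(1) \<open>z \<in> S\<close> assms(3,4)])
      (use z(2) closure_subset in blast)
  with lap[OF \<open>z \<in> S\<close> \<open>u z < v z\<close>] show False by simp
qed

section \<open>Paraboloids and rescalings\<close>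

lemma paraboloid:
  fixes p :: "'a::euclidean_space"
  shows twice_diff_on_paraboloid: "twice_diff_on UNIV (\<lambda>x. a + c * (norm (x - p))\<^sup>2)"
    and laplacian_paraboloid: "laplacian (\<lambda>x. a + c * (norm (x - p))\<^sup>2) x = 2 * c * DIM('a)"
proof -
  let ?f = "\<lambda>x. a + c * (norm (x - p))\<^sup>2"
  have 1: "(?f has_derivative (\<lambda>h. 2 * c * ((x - p) \<bullet> h))) (at x)" for x
    unfolding power2_norm_eq_inner
    by (auto intro!: derivative_eq_intros simp: inner_commute algebra_simps)
  have 2: "((\<lambda>y. 2 * c * ((y - p) \<bullet> b)) has_derivative (\<lambda>h. 2 * c * (h \<bullet> b))) (at x)" for b x
    by (auto intro!: derivative_eq_intros)
  show "twice_diff_on UNIV ?f"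
    using twice_diff_onI(1)[OF open_UNIV 1 2] .
  show "laplacian ?f x = 2 * c * DIM('a)"
    using twice_diff_onI(2)[OF open_UNIV 1 2, of x] by simp
qed

lemma rescaling:
  fixes f :: "'a::euclidean_space \<Rightarrow> real"
  assumes "open S" "open T" "twice_diff_on T f" and T: "\<And>x. x \<in> S \<Longrightarrow> s *\<^sub>R x \<in> T"
  shows twice_diff_on_rescaling: "twice_diff_on S (\<lambda>x. c * f (s *\<^sub>R x))"
    and laplacian_rescaling:
      "\<And>x. x \<in> S \<Longrightarrow> laplacian (\<lambda>x. c * f (s *\<^sub>R x)) x = c * s\<^sup>2 * laplacian f (s *\<^sub>R x)"
proof -
  have chain: "((\<lambda>x. d * F (s *\<^sub>R x)) has_derivative
      (\<lambda>h. d * s * frechet_derivative F (at (s *\<^sub>R x)) h)) (at x)"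
    if "F differentiable (at (s *\<^sub>R x))" for F :: "'a \<Rightarrow> real" and x d
  proof -
    let ?D = "frechet_derivative F (at (s *\<^sub>R x))"
    have D: "(F has_derivative ?D) (at (s *\<^sub>R x))"
      using that by (simp add: frechet_derivative_works)
    have "((\<lambda>x. s *\<^sub>R x) has_derivative (\<lambda>h. s *\<^sub>R h)) (at x)"
      by (auto intro!: derivative_eq_intros)
    from has_derivative_mult_right[OF has_derivative_compose[OF this D], of d]
    show ?thesis
      using linear_cmul[OF has_derivative_linear[OF D]] by (simp add: mult.assoc)
  qed
  have 1: "((\<lambda>x. c * f (s *\<^sub>R x)) has_derivative
      (\<lambda>b. c * s * partial_deriv b f (s *\<^sub>R x))) (at x)" if "x \<in> S" for x
    unfolding partial_deriv_def
    by (rule chain) (use assms(3) T[OF that] in \<open>auto simp: twice_diff_on_def\<close>)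
  have 2: "((\<lambda>x. c * s * partial_deriv b f (s *\<^sub>R x)) has_derivative
      (\<lambda>h. (c * s) * s * partial_deriv h (partial_deriv b f) (s *\<^sub>R x))) (at x)"
    if "b \<in> Basis" "x \<in> S" for b x
    unfolding partial_deriv_def[of _ "partial_deriv b f"]
    by (rule chain) (use assms(3) T[OF that(2)] that(1) in \<open>auto simp: twice_diff_on_def\<close>)
  show "twice_diff_on S (\<lambda>x. c * f (s *\<^sub>R x))"
    using twice_diff_onI(1)[OF assms(1) 1 2] .
  show "laplacian (\<lambda>x. c * f (s *\<^sub>R x)) x = c * s\<^sup>2 * laplacian f (s *\<^sub>R x)" if "x \<in> S" for x
    using twice_diff_onI(2)[OF assms(1) 1 2 that]
    by (simp add: laplacian_def sum_distrib_left power2_eq_square mult.assoc)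
qed

section \<open>Epigraphical cones\<close>

lemma lip_seminorm_nonneg:
  fixes f :: "'a::metric_space \<Rightarrow> 'b::metric_space"
  assumes "M-lipschitz_on S f" "x \<in> S" "y \<in> S" "x \<noteq> y"
  shows "lip_seminorm S f \<ge> 0"
proof -
  let ?Q = "{dist (f x) (f y) / dist x y | x y. x \<in> S \<and> y \<in> S \<and> x \<noteq> y}"
  have "bdd_above ?Q"
    using lipschitz_onD[OF assms(1)] by (intro bdd_aboveI[of _ M]) (auto simp: field_simps)
  with assms(2-4) have "dist (f x) (f y) / dist x y \<le> Sup ?Q"
    by (intro cSup_upper) auto
  moreover have "0 \<le> dist (f x) (f y) / dist x y" by simp
  ultimately show ?thesis unfolding lip_seminorm_def by linarith
qed

lemma C11_epigraphical_cone_abs_le: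
  fixes g :: "real ^ 'm \<Rightarrow> real"
  assumes "C11_epigraphical_cone \<Sigma> g L K"
  shows "\<bar>g x\<bar> \<le> L * norm x"
proof (cases "x = 0")
  case True
  have "g (0 *\<^sub>R 0) = 0 * g 0" using assms unfolding C11_epigraphical_cone_def by blast
  with True show ?thesis by simp
next
  case False
  let ?A = "ball 0 2 - ball 0 1 :: (real ^ 'm) set"
  obtain M where bdd: "bounded (g ` ?A)" and M: "M-lipschitz_on ?A g"
    using assms by (auto simp: C11_epigraphical_cone_def C11_on_def C01_on_def)
  define \<theta> where "\<theta> = x /\<^sub>R norm x"
  have \<theta>: "norm \<theta> = 1" "x = norm x *\<^sub>R \<theta>" using False by (auto simp: \<theta>_def)
  have \<theta>A: "\<theta> \<in> ?A" "- \<theta> \<in> ?A" "\<theta> \<noteq> - \<theta>"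
  proof -
    show "\<theta> \<in> ?A" "- \<theta> \<in> ?A" using \<theta> by auto
    show "\<theta> \<noteq> - \<theta>"
    proof
      assume "\<theta> = - \<theta>"
      then have "2 *\<^sub>R \<theta> = 0" by (metis scaleR_2 add.right_inverse)
      with \<theta>(1) show False by simp
    qed
  qed
  have "bdd_above ((\<lambda>x. \<bar>g x\<bar>) ` ?A)"
    using bdd by (auto simp: bounded_iff bdd_above_def)
  then have "\<bar>g \<theta>\<bar> \<le> (SUP x\<in>?A. \<bar>g x\<bar>)" using \<theta>A(1) by (rule cSUP_upper2) simp
  then have "\<bar>g \<theta>\<bar> \<le> L"
    using lip_seminorm_nonneg[OF M \<theta>A] assms
    by (auto simp: C11_epigraphical_cone_def C01_norm_def)
  moreover have "g x = norm x * g \<theta>"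
    using assms \<theta>(2) norm_ge_zero[of x] unfolding C11_epigraphical_cone_def by metis
  ultimately show ?thesis by (simp add: abs_mult mult.commute[of L] mult_left_mono)
qed

lemma C11_epigraphical_cone_open:
  fixes \<Sigma> :: "((real ^ 'm) \<times> real) set"
  assumes "C11_epigraphical_cone \<Sigma> g L K"
  shows "open (Cone_over \<Sigma>)"
proof -
  obtain M where M: "M-lipschitz_on (ball 0 2 - ball 0 1) g"
    using assms by (auto simp: C11_epigraphical_cone_def C11_on_def C01_on_def)
  have "isCont g x" for x
  proof (cases "x = 0")
    case True
    have "((\<lambda>y. L * norm y) \<longlongrightarrow> 0) (at 0)" by (auto intro!: tendsto_eq_intros)
    then have "(g \<longlongrightarrow> 0) (at 0)"
      by (rule Lim_null_comparison[rotated])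
        (use C11_epigraphical_cone_abs_le[OF assms] in simp)
    with True C11_epigraphical_cone_abs_le[OF assms, of 0] show ?thesis by (simp add: isCont_def)
  next
    case False
    have "continuous_on (- {0}) (\<lambda>y. norm y * g (y /\<^sub>R norm y))"
      by (intro continuous_intros continuous_on_compose2[OF lipschitz_on_continuous_on[OF M]])
        auto
    moreover have "norm y * g (y /\<^sub>R norm y) = g y" if "y \<in> - {0}" for y
    proof -
      have "g (norm y *\<^sub>R (y /\<^sub>R norm y)) = norm y * g (y /\<^sub>R norm y)"
        using assms norm_ge_zero[of y] unfolding C11_epigraphical_cone_def by blast
      with that show ?thesis by simp
    qed
    ultimately have "continuous_on (- {0}) g" by (rule continuous_on_eq)
    with False show ?thesis
      using continuous_on_eq_continuous_at[OF open_Compl[OF closed_singleton], of 0 g] by simp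
  qed
  then have "continuous_on UNIV g" by (simp add: continuous_at_imp_continuous_on)
  then have "open {z :: (real ^ 'm) \<times> real. g (fst z) < snd z}"
    by (intro open_Collect_less continuous_on_compose2[OF _ continuous_on_fst[OF continuous_on_id]]
        continuous_on_snd continuous_on_id) auto
  moreover have "Cone_over \<Sigma> = {z. g (fst z) < snd z}"
    using assms by (auto simp: C11_epigraphical_cone_def)
  ultimately show ?thesis by simp
qed

lemma Cone_over_scale: "x \<in> Cone_over \<Sigma> \<Longrightarrow> s > 0 \<Longrightarrow> s *\<^sub>R x \<in> Cone_over \<Sigma>"
  by (simp add: Cone_over_def field_simps)

lemma norm_fst_le_snd: "norm (fst z) \<le> norm z" "\<bar>snd z\<bar> \<le> norm z"
  for z :: "'a::real_normed_vector \<times> real"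
  using norm_fst_le[of "fst z" "snd z"] norm_snd_le[of "snd z" "fst z"] by auto

lemma ball_subset_epigraphical_cone:
  fixes \<Sigma> :: "((real ^ 'm) \<times> real) set"
  assumes "C11_epigraphical_cone \<Sigma> g L K" and r: "r = 1 / (2 * (1 + \<bar>L\<bar>))"
  shows "ball (0, 1/2) r \<subseteq> Cone_over \<Sigma> \<inter> ball 0 1"
proof
  fix z :: "(real ^ 'm) \<times> real" assume "z \<in> ball (0, 1/2) r"
  then have z: "norm (z - (0, 1/2)) < r" by (simp add: dist_norm norm_minus_commute)
  have r0: "r > 0" "r \<le> 1/2" and rL: "\<bar>L\<bar> * r + r = 1/2"
    by (auto simp: r divide_simps)
  have "norm z \<le> norm (z - (0, 1/2)) + norm ((0, 1/2) :: (real ^ 'm) \<times> real)"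
    using norm_triangle_ineq[of "z - (0, 1/2)" "(0, 1/2)"] by simp
  with z r0 have "norm z < 1" by (simp add: norm_Pair)
  have "norm (fst z) < r" "snd z > 1/2 - r"
    using norm_fst_le_snd[of "z - (0, 1/2)"] z by auto
  moreover have "g (fst z) \<le> \<bar>L\<bar> * r"
  proof -
    have "g (fst z) \<le> L * norm (fst z)"
      using C11_epigraphical_cone_abs_le[OF assms(1), of "fst z"] by simp
    also have "\<dots> \<le> \<bar>L\<bar> * r" using \<open>norm (fst z) < r\<close> by (intro mult_mono) auto
    finally show ?thesis .
  qed
  ultimately have "g (fst z) < snd z" using rL by linarith
  moreover have "Cone_over \<Sigma> = {z. g (fst z) < snd z}"
    using assms(1) by (auto simp: C11_epigraphical_cone_def)
  ultimately show "z \<in> Cone_over \<Sigma> \<inter> ball 0 1" using \<open>norm z < 1\<close> by simp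
qed

section \<open>The singular Dirichlet problem\<close>

lemma singular_solution_nonneg:
  assumes "singular_solution \<Omega> \<gamma> U" "x \<in> closure \<Omega>"
  shows "U x \<ge> 0"
  using assms closure_Un_frontier[of \<Omega>] unfolding singular_solution_def
  by (metis Un_iff order_less_imp_le order_refl)

lemma singular_solution_le_2:
  fixes U :: "'a::euclidean_space \<Rightarrow> real"
  assumes "\<gamma> > 0" "open \<Omega>" "\<Omega> \<subseteq> ball 0 1" "singular_solution \<Omega> \<gamma> U" "x \<in> \<Omega>"
  shows "U x \<le> 2"
proof -
  let ?w = "\<lambda>x::'a. 2 + (-1) * (norm (x - 0))\<^sup>2"
  have w1: "?w y \<ge> 1" if "y \<in> cball 0 1" for y
    using that power_le_one[of "norm y" 2] by simp
  have cl: "closure \<Omega> \<subseteq> cball 0 1"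
    using assms(3) ball_subset_cball by (intro closure_minimal) auto
  have "U x \<le> ?w x"
  proof (rule comparison_principle[of \<Omega> ?w U])
    show "bounded \<Omega>" using assms(3) bounded_ball bounded_subset by blast
    show "twice_diff_on \<Omega> ?w" by (rule twice_diff_on_subset[OF twice_diff_on_paraboloid]) simp
    show "twice_diff_on \<Omega> U" "continuous_on (closure \<Omega>) U"
      using assms(4) by (auto simp: singular_solution_def Cinf_on_imp_twice_diff_on)
    show "U y \<le> ?w y" if "y \<in> frontier \<Omega>" for y
    proof -
      have "y \<in> cball 0 1" using that cl by (auto simp: frontier_def)
      with w1[of y] that assms(4) show ?thesis by (simp add: singular_solution_def)
    qed
    show "laplacian ?w y < laplacian U y" if "y \<in> \<Omega>" "?w y < U y" for y
    proof -
      have "U y > 1" using w1[of y] that assms(3) by force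
      then have "U y powr (- \<gamma>) < 1" using assms(1) by (simp add: powr_minus_divide)
      moreover have "- laplacian U y = U y powr (- \<gamma>)"
        using assms(4) that by (simp add: singular_solution_def)
      moreover have "real DIM('a) \<ge> 1" by (simp add: DIM_ge_Suc0 Suc_leI)
      ultimately show ?thesis unfolding laplacian_paraboloid by linarith
    qed
  qed (use assms in \<open>auto intro!: continuous_intros\<close>)
  also have "\<dots> \<le> 2" by simp
  finally show ?thesis .
qed

lemma singular_solution_ge_center:
  fixes U :: "'a::euclidean_space \<Rightarrow> real"
  assumes "\<gamma> > 0" "0 < r" "r \<le> 1" "ball p r \<subseteq> \<Omega>" "singular_solution \<Omega> \<gamma> U"
  shows "r\<^sup>2 / (2 * DIM('a)) \<le> U p"
proof -
  define c where "c = 1 / (2 * real DIM('a))"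
  have D: "real DIM('a) \<ge> 1" by (simp add: DIM_ge_Suc0 Suc_leI)
  have c: "c > 0" "c \<le> 1"
  proof -
    show "c > 0" by (simp add: c_def)
    show "c \<le> 1" unfolding c_def using D by (subst divide_le_eq_1_pos) linarith+
  qed
  let ?w = "\<lambda>x. c * r\<^sup>2 + (- c) * (norm (x - p))\<^sup>2"
  have cl: "closure (ball p r) \<subseteq> closure \<Omega>" using assms(4) by (rule closure_mono)
  have "?w p \<le> U p"
  proof (rule comparison_principle[of "ball p r" U ?w])
    show "twice_diff_on (ball p r) ?w"
      by (rule twice_diff_on_subset[OF twice_diff_on_paraboloid]) simp
    show "twice_diff_on (ball p r) U"
      using assms(4,5) Cinf_on_imp_twice_diff_on twice_diff_on_subset
      unfolding singular_solution_def by blast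
    show "continuous_on (closure (ball p r)) U"
      using assms(5) cl continuous_on_subset unfolding singular_solution_def by blast
    show "?w y \<le> U y" if "y \<in> frontier (ball p r)" for y
    proof -
      have "norm (y - p) = r" using that assms(2) by (simp add: dist_norm norm_minus_commute)
      then have "?w y = 0" by simp
      moreover have "y \<in> closure \<Omega>" using that cl by (auto simp: frontier_def)
      ultimately show ?thesis using singular_solution_nonneg[OF assms(5), of y] by linarith
    qed
    show "laplacian U y < laplacian ?w y" if "y \<in> ball p r" "U y < ?w y" for y
    proof -
      have y: "y \<in> \<Omega>" using that assms(4) by blast
      have "c * r\<^sup>2 \<le> c * 1" using c assms(2,3) by (intro mult_left_mono power_le_one) auto
      moreover have "c * (norm (y - p))\<^sup>2 \<ge> 0" using c by simp
      moreover have "U y > 0" using y assms(5) by (simp add: singular_solution_def)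
      moreover have "?w y < 1 \<or> U y < 1" using that(2) calculation(1,2) c(2) by auto
      ultimately have "0 < U y" "U y < 1" using that(2) c(2) by auto
      then have "U y powr (- \<gamma>) > 1"
        using assms(1) powr_less_mono2_neg[of "- \<gamma>" "U y" 1] by simp
      moreover have "- laplacian U y = U y powr (- \<gamma>)"
        using assms(5) y by (simp add: singular_solution_def)
      moreover have "2 * (- c) * real DIM('a) = - 1" using D by (simp add: c_def)
      ultimately show ?thesis unfolding laplacian_paraboloid by linarith
    qed
    show "continuous_on (closure (ball p r)) ?w" by (intro continuous_intros)
  qed (use assms(2) in auto)
  then show ?thesis by (simp add: c_def)
qed

lemma singular_solution_le_rescaled:
  fixes U :: "'a::euclidean_space \<Rightarrow> real"
  assumes "\<gamma> > 0" "open \<Omega>" "bounded \<Omega>" "singular_solution \<Omega> \<gamma> U"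
    and s: "s > 0" and scale: "\<And>x. x \<in> \<Omega> \<Longrightarrow> s *\<^sub>R x \<in> \<Omega>" and "x \<in> \<Omega>"
  shows "U x \<le> s powr (- (2 / (1 + \<gamma>))) * U (s *\<^sub>R x)"
proof -
  define \<phi> where "\<phi> = 2 / (1 + \<gamma>)"
  let ?V = "\<lambda>x. s powr (- \<phi>) * U (s *\<^sub>R x)"
  have U2: "twice_diff_on \<Omega> U" and Uc: "continuous_on (closure \<Omega>) U"
    using assms(4) by (auto simp: singular_solution_def Cinf_on_imp_twice_diff_on)
  have cl: "s *\<^sub>R y \<in> closure \<Omega>" if "y \<in> closure \<Omega>" for y
  proof -
    have "(*\<^sub>R) s ` closure \<Omega> = closure ((*\<^sub>R) s ` \<Omega>)" by (rule closure_scaleR)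
    also have "\<dots> \<subseteq> closure \<Omega>" using scale by (intro closure_mono) auto
    finally show ?thesis using that by blast
  qed
  have "U x \<le> ?V x"
  proof (rule comparison_principle[of \<Omega> ?V U])
    show "twice_diff_on \<Omega> ?V"
      using twice_diff_on_rescaling[OF assms(2,2) U2 scale] .
    show "continuous_on (closure \<Omega>) ?V"
      using cl by (intro continuous_intros continuous_on_compose2[OF Uc]) auto
    show "U y \<le> ?V y" if "y \<in> frontier \<Omega>" for y
    proof -
      have "U (s *\<^sub>R y) \<ge> 0"
        using that cl singular_solution_nonneg[OF assms(4)] by (auto simp: frontier_def)
      with that assms(4) show ?thesis by (simp add: singular_solution_def)
    qed
    show "laplacian ?V y < laplacian U y" if y: "y \<in> \<Omega>" "?V y < U y" for y
    proof -
      define t where "t = U (s *\<^sub>R y)"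
      have t: "t > 0" "- laplacian U (s *\<^sub>R y) = t powr (- \<gamma>)"
        using assms(4) scale[OF y(1)] by (auto simp: singular_solution_def t_def)
      have "- laplacian ?V y = s powr (- \<phi>) * s\<^sup>2 * t powr (- \<gamma>)"
        using laplacian_rescaling[OF assms(2,2) U2 scale y(1)] t(2)
        by (metis mult_minus_right)
      also have "s powr (- \<phi>) * s\<^sup>2 = s powr (\<phi> * \<gamma>)"
      proof -
        have "- \<phi> + 2 = \<phi> * \<gamma>" using assms(1) by (simp add: \<phi>_def field_simps)
        then show ?thesis using s powr_add[of s "- \<phi>" 2] by simp
      qed
      also have "\<dots> * t powr (- \<gamma>) = (s powr (- \<phi>) * t) powr (- \<gamma>)"
        using s t(1) by (simp add: powr_mult powr_powr)
      also have "\<dots> > U y powr (- \<gamma>)"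
        using y(2) s t(1) assms(1) by (intro powr_less_mono2_neg) (auto simp: t_def)
      also have "U y powr (- \<gamma>) = - laplacian U y"
        using assms(4) y(1) by (simp add: singular_solution_def)
      finally show ?thesis by simp
    qed
  qed (use assms U2 Uc in auto)
  then show ?thesis by (simp add: \<phi>_def)
qed

lemma p_seq_Suc: "p_seq (Suc k) = (1/16) *\<^sub>R p_seq k"
proof -
  have "(16::real) powi (1 - int (Suc k)) = 16 powi (1 - int k) / 16"
    using power_int_diff[of "16::real" "1 - int k" 1] by simp
  then show ?thesis by (simp add: p_seq_def)
qed

lemma p_seq_1: "p_seq 1 = (0, 1/2)"
  by (simp add: p_seq_def)

theorem lemma3p1:
  fixes \<gamma> L K :: real
  assumes "\<gamma> > 0"
  shows "\<exists>C>0. \<forall>(\<Sigma> :: ((real ^ 'm) \<times> real) set) g \<phi> U.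
    C11_epigraphical_cone \<Sigma> g L K \<longrightarrow>
    is_frequency \<Sigma> \<phi> \<longrightarrow>
    \<phi> = 2 / (1 + \<gamma>) \<longrightarrow>
    singular_solution (Cone_over \<Sigma> \<inter> ball 0 1) \<gamma> U \<longrightarrow>
      (inverse C \<le> a_seq \<phi> U 1 \<and> a_seq \<phi> U 1 \<le> C) \<and>
      (\<forall>k\<ge>1. a_seq \<phi> U (k + 1) \<ge> a_seq \<phi> U k)"
proof -
  define \<phi> where "\<phi> = 2 / (1 + \<gamma>)"
  define r where "r = 1 / (2 * (1 + \<bar>L\<bar>))"
  define m where "m = 16 powr \<phi> * (r\<^sup>2 / (2 * DIM((real ^ 'm) \<times> real)))"
  define C where "C = max (inverse m) (16 powr \<phi> * 2)"
  have r: "0 < r" "r \<le> 1" by (auto simp: r_def divide_simps)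
  have m: "m > 0" using r by (simp add: m_def)
  have C: "C > 0" "inverse C \<le> m" "16 powr \<phi> * 2 \<le> C"
  proof -
    show "C > 0" unfolding C_def using m by (simp add: less_max_iff_disj)
    show "inverse C \<le> m"
      using le_imp_inverse_le[of "inverse m" C] m by (simp add: C_def)
    show "16 powr \<phi> * 2 \<le> C" by (simp add: C_def)
  qed
  show ?thesis
  proof (intro exI[of _ C] conjI allI impI C(1))
    fix \<Sigma> :: "((real ^ 'm) \<times> real) set" and g \<phi>' U
    assume cone: "C11_epigraphical_cone \<Sigma> g L K" and "\<phi>' = 2 / (1 + \<gamma>)"
      and sol: "singular_solution (Cone_over \<Sigma> \<inter> ball 0 1) \<gamma> U"
    then have \<phi>': "\<phi>' = \<phi>" by (simp add: \<phi>_def)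
    define \<Omega> where "\<Omega> = Cone_over \<Sigma> \<inter> ball 0 1"
    note sol = sol[folded \<Omega>_def]
    have "open \<Omega>" unfolding \<Omega>_def using C11_epigraphical_cone_open[OF cone] by blast
    have "bounded \<Omega>" unfolding \<Omega>_def by (simp add: bounded_Int)
    have scale: "(1/16) *\<^sub>R x \<in> \<Omega>" if "x \<in> \<Omega>" for x
      using that Cone_over_scale[of x \<Sigma> "1/16"] by (simp add: \<Omega>_def)
    have ball: "ball (p_seq 1) r \<subseteq> \<Omega>"
      unfolding p_seq_1 \<Omega>_def by (rule ball_subset_epigraphical_cone[OF cone r_def])
    have p: "p_seq k \<in> \<Omega>" if "k \<ge> 1" for k
      using that
    proof (induction k rule: dec_induct)
      case base
      show ?case using ball r by auto
    next
      case (step k)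
      then show ?case using scale by (simp add: p_seq_Suc)
    qed
    have "m \<le> 16 powr \<phi> * U (p_seq 1)"
      unfolding m_def by (intro mult_left_mono singular_solution_ge_center[OF assms r ball sol]) simp
    then have "m \<le> a_seq \<phi> U 1" by (simp add: a_seq_def)
    then show "inverse C \<le> a_seq \<phi>' U 1" using C(2) \<phi>' by simp
    have "U (p_seq 1) \<le> 2"
      by (rule singular_solution_le_2[OF assms \<open>open \<Omega>\<close> _ sol p]) (auto simp: \<Omega>_def)
    then have "a_seq \<phi> U 1 \<le> 16 powr \<phi> * 2" by (simp add: a_seq_def)
    then show "a_seq \<phi>' U 1 \<le> C" using C(3) \<phi>' by simp
    fix k :: nat assume "k \<ge> 1"
    have "U (p_seq k) \<le> (1/16) powr (- \<phi>) * U ((1/16) *\<^sub>R p_seq k)"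
      unfolding \<phi>_def
      by (rule singular_solution_le_rescaled[OF assms \<open>open \<Omega>\<close> \<open>bounded \<Omega>\<close> sol _ scale])
        (use p \<open>k \<ge> 1\<close> in auto)
    also have "(1/16) powr (- \<phi>) = 16 powr \<phi>" by (simp add: powr_minus powr_divide)
    finally have "16 powr (real k * \<phi>) * U (p_seq k)
        \<le> 16 powr (real k * \<phi>) * (16 powr \<phi> * U (p_seq (Suc k)))"
      by (simp add: p_seq_Suc)
    also have "\<dots> = a_seq \<phi> U (Suc k)"
      by (simp add: a_seq_def distrib_right powr_add)
    finally show "a_seq \<phi>' U k \<le> a_seq \<phi>' U (k + 1)" by (simp add: a_seq_def \<phi>')
  qed
qed

end
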